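(* Consider the adjacency-list model augmented with $\texttt{JUMP}$, $\texttt{IN-SORTED}$ and $\texttt{ADJ}$. For any $n$ and $m$ with $n\le m\le n^2$ and any $\delta\in(0,1]$, there exists a directed graph $G=(V,E)$ with $\Theta(n)$ nodes and $\Theta(m)$ edges such that for any algorithm solving the single-pair problem, the expected running time on $G$ with approximation threshold $\delta$, averaged over all sources $s\in V$ and targets $t\in V$, is $\Omega\big(\min\{m,(d/\delta)^{1/2},(1/\delta)^{2/3}\}\big)$, where $d=m/n$.
   Context: Fix a constant $\alpha\in(0,1)$. For a directed graph $G=(V,E)$, an $\alpha$-discounted random walk from a node $s$: at each step, with probability $\alpha$ it terminates at the current node, and otherwise it moves to a uniformly random out-neighbor of the current node. $\pi(s,t)$ is the probability that such a walk from $s$ terminates at $t$. Adjacency-list model: an algorithm accesses $G$ only through constant-time queries $\texttt{DEG-IN}(u)$, $\texttt{DEG-OUT}(u)$ (in-/out-degree of $u$), $\texttt{IN}(u,i)$, $\texttt{OUT}(u,i)$ ($i$-th in-/out-neighbor of $u$). Additional queries: $\texttt{ADJ}(u,v)$ returns whether $(u,v)\in E$; $\texttt{IN-SORTED}(u,i)$ returns the $i$-th in-neighbor of $u$ when in-neighbors are sorted by out-degree; $\texttt{JUMP}()$ returns a uniformly random node of $V$. Single-pair problem: given $G$ (via queries), $s,t\in V$ and $\delta\in(0,1]$, output $\hat\pi(s,t)$ with $\Pr\{|\hat\pi(s,t)-\pi(s,t)|\ge\varepsilon\max\{\pi(s,t),\delta\}\}\le p_f$, where $\varepsilon,p_f$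 are fixed small constants; an algorithm solves the problem if this holds for every input. *)

theory Defs
  imports "HOL-Probability.SPMF" "Graph_Theory.Pair_Digraph"
begin

text \<open>
  Directed graphs are finite, have no parallel arcs and may have self-loops.  Every node has an
  out-neighbour, so that the random walk can always move on.
\<close>

definition sinkless_digraph :: "nat pair_pre_digraph \<Rightarrow> bool" where
  "sinkless_digraph G \<longleftrightarrow> pair_fin_digraph G \<and> (\<forall>u\<in>pverts G. 0 < out_degree (with_proj G) u)"

definition out_neighbours :: "nat pair_pre_digraph \<Rightarrow> nat \<Rightarrow> nat set" where
  "out_neighbours G u = {v. (u, v) \<in> parcs G}"

definition in_neighbours :: "nat pair_pre_digraph \<Rightarrow> nat \<Rightarrow> nat set" where
  "in_neighbours G v = {u. (u, v) \<in> parcs G}"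

text \<open>
  The node at which an \<^term>\<open>\<alpha>\<close>-discounted random walk from \<^term>\<open>u\<close> terminates; the missing mass
  of the subprobability distribution is the probability that the walk never terminates.
\<close>

partial_function (spmf) discounted_walk :: "real \<Rightarrow> nat pair_pre_digraph \<Rightarrow> nat \<Rightarrow> nat spmf" where
  "discounted_walk \<alpha> G u =
     bind_pmf (bernoulli_pmf \<alpha>) (\<lambda>stop.
       if stop then return_spmf u
       else bind_spmf (spmf_of_set (out_neighbours G u)) (\<lambda>v. discounted_walk \<alpha> G v))"

definition ppr :: "real \<Rightarrow> nat pair_pre_digraph \<Rightarrow> nat \<Rightarrow> nat \<Rightarrow> real" where
  "ppr \<alpha> G s t = spmf (discounted_walk \<alpha> G s) t"

record adj_lists =
  out_list :: "nat \<Rightarrow> nat list"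
  in_list :: "nat \<Rightarrow> nat list"
  in_sorted_list :: "nat \<Rightarrow> nat list"

text \<open>The order of the lists, and of ties in the sorted one, is otherwise arbitrary.\<close>

definition adj_lists_of :: "nat pair_pre_digraph \<Rightarrow> adj_lists \<Rightarrow> bool" where
  "adj_lists_of G L \<longleftrightarrow> (\<forall>u.
     distinct (out_list L u) \<and> set (out_list L u) = out_neighbours G u \<and>
     distinct (in_list L u) \<and> set (in_list L u) = in_neighbours G u \<and>
     distinct (in_sorted_list L u) \<and> set (in_sorted_list L u) = in_neighbours G u \<and>
     sorted (map (out_degree (with_proj G)) (in_sorted_list L u)))"

datatype query =
    DEG_IN nat | DEG_OUT nat | IN nat nat | OUT nat nat
  | ADJ nat nat | IN_SORTED nat nat | JUMP

datatype answer = Degree nat | Node nat | No_Such_Node | Adjacent bool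

text \<open>Positions in adjacency lists are counted from 1.\<close>

definition entry :: "nat list \<Rightarrow> nat \<Rightarrow> answer" where
  "entry xs i = (if 1 \<le> i \<and> i \<le> length xs then Node (xs ! (i - 1)) else No_Such_Node)"

primrec response :: "nat pair_pre_digraph \<Rightarrow> adj_lists \<Rightarrow> query \<Rightarrow> answer pmf" where
  "response G L (DEG_IN u) = return_pmf (Degree (in_degree (with_proj G) u))"
| "response G L (DEG_OUT u) = return_pmf (Degree (out_degree (with_proj G) u))"
| "response G L (IN u i) = return_pmf (entry (in_list L u) i)"
| "response G L (OUT u i) = return_pmf (entry (out_list L u) i)"
| "response G L (ADJ u v) = return_pmf (Adjacent ((u, v) \<in> parcs G))"
| "response G L (IN_SORTED u i) = return_pmf (entry (in_sorted_list L u) i)"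
| "response G L JUMP = map_pmf Node (pmf_of_set (pverts G))"

text \<open>
  A randomized computation with query access to a graph: it halts with an output, performs an
  internal (possibly random) step, or asks a query and continues depending on the answer.  Being a
  codatatype, this includes computations without a bound on their length.
\<close>

codatatype computation =
    Halt real
  | Local "computation pmf"
  | Ask query "answer \<Rightarrow> computation"

text \<open>
  The joint distribution of output and running time, where every step, including halting, takes
  one unit of time; the missing mass is the probability of not terminating.
\<close>

partial_function (spmf) exec ::
  "nat pair_pre_digraph \<Rightarrow> adj_lists \<Rightarrow> computation \<Rightarrow> (real \<times> nat) spmf" where
  "exec G L c = (case c of
      Halt x \<Rightarrow> return_spmf (x, 1)
    | Local p \<Rightarrow> bind_pmf p (\<lambda>c'. map_spmf (apsnd Suc) (exec G L c'))
    | Ask q k \<Rightarrow> bind_pmf (response G L q) (\<lambda>a. map_spmf (apsnd Suc) (exec G L (k a))))"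

definition expected_time :: "nat pair_pre_digraph \<Rightarrow> adj_lists \<Rightarrow> computation \<Rightarrow> ennreal" where
  "expected_time G L c =
     (\<integral>\<^sup>+ r. (case r of None \<Rightarrow> \<infinity> | Some (x, \<tau>) \<Rightarrow> of_nat \<tau>) \<partial>measure_pmf (exec G L c))"

text \<open>The inputs of an algorithm are the source, the target and the threshold.\<close>

type_synonym algorithm = "nat \<Rightarrow> nat \<Rightarrow> real \<Rightarrow> computation"

text \<open>Not terminating counts as a failure.\<close>

definition solves_single_pair :: "real \<Rightarrow> real \<Rightarrow> real \<Rightarrow> algorithm \<Rightarrow> bool" where
  "solves_single_pair \<alpha> \<epsilon> p\<^sub>f A \<longleftrightarrow>
     (\<forall>G L s t \<delta>. sinkless_digraph G \<longrightarrow> adj_lists_of G L \<longrightarrow>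
        s \<in> pverts G \<longrightarrow> t \<in> pverts G \<longrightarrow> 0 < \<delta> \<longrightarrow> \<delta> \<le> 1 \<longrightarrow>
        measure_pmf.prob (exec G L (A s t \<delta>))
          {r. case r of None \<Rightarrow> True
              | Some (x, \<tau>) \<Rightarrow> \<bar>x - ppr \<alpha> G s t\<bar> \<ge> \<epsilon> * max (ppr \<alpha> G s t) \<delta>} \<le> p\<^sub>f)"

definition average_expected_time ::
  "nat pair_pre_digraph \<Rightarrow> adj_lists \<Rightarrow> algorithm \<Rightarrow> real \<Rightarrow> ennreal" where
  "average_expected_time G L A \<delta> =
     (\<Sum>s\<in>pverts G. \<Sum>t\<in>pverts G. expected_time G L (A s t \<delta>)) / of_nat (card (pverts G) ^ 2)"

end

theory Submission
  imports Defs "HOL-Combinatorics.Transposition" "HOL-Library.Countable"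
begin

text \<open>
  In the graph \<^term>\<open>G\<close> a walk from a source \<^term>\<open>s\<close> never reaches a target \<^term>\<open>t\<close>.  Exchanging the
  heads of an arc in a complete bipartite graph near \<^term>\<open>s\<close> and of one near \<^term>\<open>t\<close>, with \<^term>\<open>B\<close> arcs
  each, raises the value to at least a constant multiple of \<^term>\<open>\<delta>\<close>, but keeps all degrees.  A correct
  algorithm run on \<^term>\<open>G\<close> must therefore, for each of the \<^term>\<open>B ^ 2\<close> exchanges, ask with probability
  at least \<^term>\<open>1 - 2 * p\<^sub>f\<close> a query whose answer the exchange alters.  A single query is affected by at
  most \<^term>\<open>4 * B\<close> exchanges, so the expected number of queries is of order \<^term>\<open>B\<close>.
\<close>

section \<open>Running time of computations\<close>

lemma exec_Halt: "exec G L (Halt x) = return_spmf (x, 1)"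
  by (subst exec.simps) simp

lemma exec_Local:
  "exec G L (Local p) = bind_pmf p (\<lambda>c. map_spmf (apsnd Suc) (exec G L c))"
  by (subst exec.simps) simp

lemma exec_Ask:
  "exec G L (Ask q f) = bind_pmf (response G L q) (\<lambda>a. map_spmf (apsnd Suc) (exec G L (f a)))"
  by (subst exec.simps) simp

definition time_of :: "(real \<times> nat) option \<Rightarrow> ennreal" where
  "time_of r = (case r of None \<Rightarrow> \<infinity> | Some (x, \<tau>) \<Rightarrow> of_nat \<tau>)"

lemma expected_time_eq: "expected_time G L c = (\<integral>\<^sup>+ r. time_of r \<partial>measure_pmf (exec G L c))"
  by (simp add: expected_time_def time_of_def)

lemma time_of_map: "time_of (map_option (apsnd Suc) r) = 1 + time_of r"
  by (auto simp: time_of_def split: option.splits)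

lemma nn_integral_time_of_map:
  "(\<integral>\<^sup>+ r. time_of r \<partial>measure_pmf (map_spmf (apsnd Suc) p)) = 1 + (\<integral>\<^sup>+ r. time_of r \<partial>measure_pmf p)"
  by (simp add: time_of_map nn_integral_add)

lemma expected_time_Halt: "expected_time G L (Halt x) = 1"
  by (simp add: expected_time_eq exec_Halt time_of_def)

lemma expected_time_Local:
  "expected_time G L (Local p) = 1 + (\<integral>\<^sup>+ c. expected_time G L c \<partial>measure_pmf p)"
  by (simp add: expected_time_eq exec_Local nn_integral_time_of_map nn_integral_add del: nn_integral_map_pmf)

lemma expected_time_Ask:
  "expected_time G L (Ask q f) =
     1 + (\<integral>\<^sup>+ a. expected_time G L (f a) \<partial>measure_pmf (response G L q))"
  by (simp add: expected_time_eq exec_Ask nn_integral_time_of_map nn_integral_add del: nn_integral_map_pmf)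

text \<open>This settles large thresholds, where the claimed bound does not exceed 1.\<close>

lemma one_le_expected_time: "1 \<le> expected_time G L c"
  by (cases c) (simp_all add: expected_time_Halt expected_time_Local expected_time_Ask)

section \<open>Runs truncated in time, and the detection of a set of queries\<close>

text \<open>Computations are coinductive and may run forever; the cutoff \<open>k\<close> supplies
  an induction and is removed at the end by a supremum.\<close>

definition halts_within :: "nat \<Rightarrow> real set \<Rightarrow> (real \<times> nat) option set" where
  "halts_within k X = {r. \<exists>x \<tau>. r = Some (x, \<tau>) \<and> x \<in> X \<and> \<tau> \<le> k}"

lemma vimage_halts_within_Suc:
  "map_option (apsnd Suc) -` halts_within (Suc k) X = halts_within k X"
  by (auto simp: halts_within_def map_option_case split: option.splits)

lemma vimage_halts_within_0: "map_option (apsnd Suc) -` halts_within 0 X = {}"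
  by (auto simp: halts_within_def map_option_case split: option.splits)

lemma emeasure_halts_within_0: "emeasure (measure_pmf (exec G L c)) (halts_within 0 X) = 0"
proof (cases c)
  case (Halt x)
  then show ?thesis by (simp add: exec_Halt halts_within_def)
next
  case (Local p)
  then show ?thesis by (simp add: exec_Local vimage_halts_within_0)
next
  case (Ask q f)
  then show ?thesis by (simp add: exec_Ask vimage_halts_within_0)
qed

text \<open>The probability that one of the first \<open>k\<close> steps on \<open>G\<close> asks a
  query in \<open>Q\<close>. It has its own recursion because \<open>exec\<close> does not record
  the queries.\<close>

primrec detection ::
  "nat pair_pre_digraph \<Rightarrow> adj_lists \<Rightarrow> query set \<Rightarrow> nat \<Rightarrow> computation \<Rightarrow> ennreal" where
  "detection G L Q 0 c = 0"
| "detection G L Q (Suc k) c = (case c of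
      Halt x \<Rightarrow> 0
    | Local p \<Rightarrow> (\<integral>\<^sup>+ c'. detection G L Q k c' \<partial>measure_pmf p)
    | Ask q f \<Rightarrow> if q \<in> Q then 1
                else (\<integral>\<^sup>+ a. detection G L Q k (f a) \<partial>measure_pmf (response G L q)))"

text \<open>Coupling: the runs on the two graphs agree until a query in \<open>Q\<close> is asked,
  and from then on the detection value 1 bounds any probability.\<close>

lemma exec_le_exec_plus_detection:
  assumes "\<And>q. q \<notin> Q \<Longrightarrow> response G' L' q = response G L q"
  shows "emeasure (measure_pmf (exec G' L' c)) (halts_within k X)
    \<le> emeasure (measure_pmf (exec G L c)) (halts_within k X) + detection G L Q k c"
proof (induction k arbitrary: c)
  case 0
  show ?case by (simp add: emeasure_halts_within_0)
next
  case (Suc k)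
  show ?case
  proof (cases c)
    case (Halt x)
    then show ?thesis by (simp add: exec_Halt)
  next
    case (Local p)
    then show ?thesis
      using nn_integral_mono[OF Suc.IH, of "measure_pmf p" "\<lambda>c. c"]
      by (simp add: exec_Local vimage_halts_within_Suc nn_integral_add)
  next
    case (Ask q f)
    show ?thesis
    proof (cases "q \<in> Q")
      case True
      then show ?thesis
        using Ask measure_pmf.emeasure_le_1[of "exec G' L' c" "halts_within (Suc k) X"]
        by (simp add: add_increasing)
    next
      case False
      then show ?thesis
        using Ask nn_integral_mono[OF Suc.IH, of "measure_pmf (response G L q)" f]
        by (simp add: exec_Ask vimage_halts_within_Suc nn_integral_add assms)
    qed
  qed
qed

text \<open>Double counting: each step costs one unit of time, and a query asked in it is charged to
  at most \<open>M\<close> of the indices.\<close>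

lemma sum_detection_le:
  assumes "finite I" and M: "\<And>q. card {i \<in> I. q \<in> Q i} \<le> M"
  shows "(\<Sum>i\<in>I. detection G L (Q i) k c) \<le> of_nat M * expected_time G L c"
proof (induction k arbitrary: c)
  case 0
  show ?case by simp
next
  case (Suc k)
  show ?case
  proof (cases c)
    case (Halt x)
    then show ?thesis by simp
  next
    case (Local p)
    have "(\<Sum>i\<in>I. detection G L (Q i) (Suc k) c)
        = (\<integral>\<^sup>+ c'. (\<Sum>i\<in>I. detection G L (Q i) k c') \<partial>measure_pmf p)"
      by (simp add: Local nn_integral_sum)
    also have "\<dots> \<le> (\<integral>\<^sup>+ c'. of_nat M * expected_time G L c' \<partial>measure_pmf p)"
      by (intro nn_integral_mono Suc.IH)
    also have "\<dots> \<le> of_nat M * expected_time G L c"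
      by (simp add: Local expected_time_Local nn_integral_cmult distrib_left)
    finally show ?thesis .
  next
    case (Ask q f)
    let ?R = "measure_pmf (response G L q)"
    \<comment> \<open>Letting the run continue after a detection only increases the bound, and it
      separates the present query from the later ones.\<close>
    have "(\<Sum>i\<in>I. detection G L (Q i) (Suc k) c)
        \<le> (\<Sum>i\<in>I. (if q \<in> Q i then 1 else 0) + (\<integral>\<^sup>+ a. detection G L (Q i) k (f a) \<partial>?R))"
      by (intro sum_mono) (simp add: Ask)
    also have "\<dots> = of_nat (card {i \<in> I. q \<in> Q i})
        + (\<integral>\<^sup>+ a. (\<Sum>i\<in>I. detection G L (Q i) k (f a)) \<partial>?R)"
      using \<open>finite I\<close> by (simp add: sum.distrib nn_integral_sum flip: sum.inter_filter)
    also have "\<dots> \<le> of_nat M + (\<integral>\<^sup>+ a. of_nat M * expected_time G L (f a) \<partial>?R)"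
      by (intro add_mono nn_integral_mono Suc.IH) (simp add: M)
    also have "\<dots> = of_nat M * expected_time G L c"
      by (simp add: Ask expected_time_Ask nn_integral_cmult distrib_left)
    finally show ?thesis .
  qed
qed

lemma emeasure_halts_eq_SUP:
  "emeasure (measure_pmf p) {r. \<exists>x \<tau>. r = Some (x, \<tau>) \<and> x \<in> X}
    = (SUP k. emeasure (measure_pmf p) (halts_within k X))"
proof -
  have "{r. \<exists>x \<tau>. r = Some (x, \<tau>) \<and> x \<in> X} = (\<Union>k. halts_within k X)"
    by (auto simp: halts_within_def)
  moreover have "incseq (\<lambda>k. halts_within k X)"
    by (auto simp: incseq_def halts_within_def)
  ultimately show ?thesis
    by (simp add: SUP_emeasure_incseq)
qed

section \<open>Termination probabilities of discounted walks\<close>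

lemma ppr_nonneg: "0 \<le> ppr \<alpha> G u t"
  by (simp add: ppr_def)

text \<open>Conditioning on the first step. Without out-neighbours the quotient is 0, which agrees
  with the mass lost by \<open>spmf_of_set\<close>.\<close>

lemma ppr_unfold:
  assumes "0 \<le> \<alpha>" "\<alpha> \<le> 1"
  shows "ppr \<alpha> G u t = \<alpha> * (if u = t then 1 else 0) +
    (1 - \<alpha>) * ((\<Sum>v\<in>out_neighbours G u. ppr \<alpha> G v t) / card (out_neighbours G u))"
proof -
  have "ppr \<alpha> G u t = (\<Sum>b\<in>UNIV. pmf (bernoulli_pmf \<alpha>) b *
      spmf (if b then return_spmf u else bind_spmf (spmf_of_set (out_neighbours G u)) (discounted_walk \<alpha> G)) t)"
    unfolding ppr_def
    by (subst discounted_walk.simps) (simp add: pmf_bind integral_measure_pmf[of UNIV])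
  then show ?thesis
    using assms by (simp add: UNIV_bool spmf_bind integral_spmf_of_set ppr_def)
qed

text \<open>Keeps a single summand of the recursion, so that lower bounds can be chained along a
  path.\<close>

lemma ppr_ge_step:
  assumes "0 \<le> \<alpha>" "\<alpha> \<le> 1" "finite (out_neighbours G u)" "v \<in> out_neighbours G u" "p \<le> ppr \<alpha> G v t"
  shows "(1 - \<alpha>) * (p / card (out_neighbours G u)) \<le> ppr \<alpha> G u t"
proof -
  have "p \<le> (\<Sum>v\<in>out_neighbours G u. ppr \<alpha> G v t)"
    using assms(5) member_le_sum[OF assms(4), of "\<lambda>v. ppr \<alpha> G v t"] assms(3) ppr_nonneg by force
  then have "(1 - \<alpha>) * (p / card (out_neighbours G u))
      \<le> (1 - \<alpha>) * ((\<Sum>v\<in>out_neighbours G u. ppr \<alpha> G v t) / card (out_neighbours G u))"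
    using assms(2) by (intro mult_left_mono divide_right_mono) auto
  also have "\<dots> \<le> ppr \<alpha> G u t"
    using assms(1,2) by (subst ppr_unfold[of \<alpha> G u t]) auto
  finally show ?thesis .
qed

lemma ppr_self_ge:
  assumes "0 \<le> \<alpha>" "\<alpha> \<le> 1"
  shows "\<alpha> \<le> ppr \<alpha> G t t"
  using assms by (subst ppr_unfold) (auto intro!: mult_nonneg_nonneg divide_nonneg_nonneg sum_nonneg ppr_nonneg)

text \<open>Inside \<open>C\<close> the recursion never picks up a stop at \<open>t\<close>, so
  \<open>k\<close> unfoldings leave at most the probability \<open>(1 - \<alpha>) ^ k\<close> of
  still walking, which tends to 0.\<close>

lemma ppr_eq_0:
  assumes "0 < \<alpha>" "\<alpha> \<le> 1" and closed: "\<And>u. u \<in> C \<Longrightarrow> out_neighbours G u \<subseteq> C" and "t \<notin> C" "u \<in> C"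
  shows "ppr \<alpha> G u t = 0"
proof -
  have bound: "ppr \<alpha> G u t \<le> (1 - \<alpha>) ^ k" if "u \<in> C" for u k
    using that
  proof (induction k arbitrary: u)
    case 0
    show ?case by (simp add: ppr_def pmf_le_1)
  next
    case (Suc k)
    have "(\<Sum>v\<in>out_neighbours G u. ppr \<alpha> G v t) \<le> card (out_neighbours G u) * (1 - \<alpha>) ^ k"
      using closed[OF Suc.prems] Suc.IH sum_bounded_above[of "out_neighbours G u" "\<lambda>v. ppr \<alpha> G v t"] by blast
    then have "(\<Sum>v\<in>out_neighbours G u. ppr \<alpha> G v t) / card (out_neighbours G u) \<le> (1 - \<alpha>) ^ k"
      using \<open>\<alpha> \<le> 1\<close> by (cases "card (out_neighbours G u) = 0") (auto simp: field_simps)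
    from mult_left_mono[OF this, of "1 - \<alpha>"] show ?case
      using assms Suc.prems by (subst ppr_unfold) auto
  qed
  have "(\<lambda>k. (1 - \<alpha>) ^ k) \<longlonglongrightarrow> 0"
    using assms by (intro LIMSEQ_realpow_zero) auto
  then have "ppr \<alpha> G u t \<le> 0"
    using bound[OF \<open>u \<in> C\<close>] by (intro LIMSEQ_le_const) auto
  then show ?thesis
    using ppr_nonneg[of \<alpha> G u t] by simp
qed

section \<open>Degrees and neighbourhoods\<close>

lemma out_degree_eq_card: "out_degree (with_proj G) u = card (out_neighbours G u)"
proof -
  have "out_arcs (with_proj G) u = Pair u ` out_neighbours G u"
    by (auto simp: out_arcs_def out_neighbours_def)
  then show ?thesis
    by (simp add: out_degree_def card_image inj_on_def)
qed

lemma in_degree_eq_card: "in_degree (with_proj G) v = card (in_neighbours G v)"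
proof -
  have "in_arcs (with_proj G) v = (\<lambda>u. (u, v)) ` in_neighbours G v"
    by (auto simp: in_arcs_def in_neighbours_def)
  then show ?thesis
    by (simp add: in_degree_def card_image inj_on_def)
qed

lemma finite_out_neighbours:
  assumes "finite (parcs G)"
  shows "finite (out_neighbours G u)"
proof -
  have "out_neighbours G u \<subseteq> snd ` parcs G"
    by (force simp: out_neighbours_def)
  then show ?thesis
    using assms finite_surj by blast
qed

lemma sinkless_digraph_iff:
  "sinkless_digraph G \<longleftrightarrow> finite (pverts G) \<and> finite (parcs G) \<and>
     (\<forall>(u, v)\<in>parcs G. u \<in> pverts G \<and> v \<in> pverts G) \<and> (\<forall>u\<in>pverts G. out_neighbours G u \<noteq> {})"
  (is "_ \<longleftrightarrow> ?R")
proof -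
  have "pair_fin_digraph G \<longleftrightarrow> finite (pverts G) \<and> finite (parcs G) \<and>
      (\<forall>(u, v)\<in>parcs G. u \<in> pverts G \<and> v \<in> pverts G)"
    by (fastforce simp: pair_fin_digraph_def pair_wf_digraph_def pair_fin_digraph_axioms_def)
  then show ?thesis
    by (auto simp: sinkless_digraph_def out_degree_eq_card card_gt_0_iff finite_out_neighbours)
qed

section \<open>Exchanging the heads of two arcs\<close>

definition swap_arcs ::
  "nat pair_pre_digraph \<Rightarrow> nat \<times> nat \<Rightarrow> nat \<times> nat \<Rightarrow> nat pair_pre_digraph" where
  "swap_arcs G e f = \<lparr>pverts = pverts G,
     parcs = parcs G - {e, f} \<union> {(fst e, snd f), (fst f, snd e)}\<rparr>"

text \<open>Entries are replaced in place, so that for swappable arcs the lists of the two graphs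
  differ only at the positions holding \<open>e\<close> or \<open>f\<close>.\<close>

definition swap_lists :: "adj_lists \<Rightarrow> nat \<times> nat \<Rightarrow> nat \<times> nat \<Rightarrow> adj_lists" where
  "swap_lists L e f =
     \<lparr>out_list = \<lambda>w. if w \<in> {fst e, fst f}
        then map (Transposition.transpose (snd e) (snd f)) (out_list L w) else out_list L w,
      in_list = \<lambda>w. if w \<in> {snd e, snd f}
        then map (Transposition.transpose (fst e) (fst f)) (in_list L w) else in_list L w,
      in_sorted_list = \<lambda>w. if w \<in> {snd e, snd f}
        then map (Transposition.transpose (fst e) (fst f)) (in_sorted_list L w) else in_sorted_list L w\<rparr>"

text \<open>Absence of the crossing pairs forces distinct tails and distinct heads and prevents arcs
  from merging. Equal out-degrees of the tails keep the sorted in-lists sorted.\<close>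

definition swappable :: "nat pair_pre_digraph \<Rightarrow> nat \<times> nat \<Rightarrow> nat \<times> nat \<Rightarrow> bool" where
  "swappable G e f \<longleftrightarrow> e \<in> parcs G \<and> f \<in> parcs G \<and>
     (fst e, snd f) \<notin> parcs G \<and> (fst f, snd e) \<notin> parcs G \<and>
     card (out_neighbours G (fst e)) = card (out_neighbours G (fst f))"

text \<open>The tail of an exchanged arc sees exactly one of the two heads, so the exchange acts as
  a transposition. In this form cardinalities and lists carry over by injectivity.\<close>

lemma out_neighbours_swap_arcs:
  assumes "swappable G e f"
  shows "out_neighbours (swap_arcs G e f) w =
    (if w \<in> {fst e, fst f} then Transposition.transpose (snd e) (snd f) ` out_neighbours G w
     else out_neighbours G w)"
  using assms
  by (cases e; cases f)
    (auto simp: swappable_def out_neighbours_def swap_arcs_def in_transpose_image_iff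
      Transposition.transpose_def split: if_splits)

lemma in_neighbours_swap_arcs:
  assumes "swappable G e f"
  shows "in_neighbours (swap_arcs G e f) w =
    (if w \<in> {snd e, snd f} then Transposition.transpose (fst e) (fst f) ` in_neighbours G w
     else in_neighbours G w)"
  using assms
  by (cases e; cases f)
    (auto simp: swappable_def in_neighbours_def swap_arcs_def in_transpose_image_iff
      Transposition.transpose_def split: if_splits)

lemma card_out_neighbours_swap_arcs:
  assumes "swappable G e f"
  shows "card (out_neighbours (swap_arcs G e f) w) = card (out_neighbours G w)"
  by (simp add: out_neighbours_swap_arcs[OF assms] card_image)

lemma card_in_neighbours_swap_arcs:
  assumes "swappable G e f"
  shows "card (in_neighbours (swap_arcs G e f) w) = card (in_neighbours G w)"
  by (simp add: in_neighbours_swap_arcs[OF assms] card_image)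

lemma sinkless_digraph_swap_arcs:
  assumes "swappable G e f" "sinkless_digraph G"
  shows "sinkless_digraph (swap_arcs G e f)"
proof -
  have "\<forall>u\<in>pverts G. out_neighbours (swap_arcs G e f) u \<noteq> {}"
    using assms by (simp add: out_neighbours_swap_arcs sinkless_digraph_iff)
  then show ?thesis
    using assms by (cases e; cases f) (auto simp: sinkless_digraph_iff swap_arcs_def swappable_def)
qed

text \<open>The tails exchanged in an in-list have equal out-degree, so the sequence of out-degrees
  along each sorted list does not change at all.\<close>

lemma adj_lists_of_swap:
  assumes "swappable G e f" "adj_lists_of G L"
  shows "adj_lists_of (swap_arcs G e f) (swap_lists L e f)"
proof -
  have "out_degree (with_proj G) \<circ> Transposition.transpose (fst e) (fst f) = out_degree (with_proj G)"
    using assms(1) by (auto simp: fun_eq_iff swappable_def out_degree_eq_card Transposition.transpose_def)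
  moreover have "out_degree (with_proj (swap_arcs G e f)) = out_degree (with_proj G)"
    using assms(1) by (simp add: fun_eq_iff out_degree_eq_card card_out_neighbours_swap_arcs)
  ultimately have "map (out_degree (with_proj (swap_arcs G e f))) (in_sorted_list (swap_lists L e f) w)
      = map (out_degree (with_proj G)) (in_sorted_list L w)" for w
    by (cases "w \<in> {snd e, snd f}") (simp_all only: swap_lists_def adj_lists.simps map_map if_True if_False)
  then show ?thesis
    using assms
    by (simp add: adj_lists_of_def)
      (simp add: swap_lists_def distinct_map out_neighbours_swap_arcs in_neighbours_swap_arcs)
qed

text \<open>
  Any query whose answer changes under the swap of \<^term>\<open>e\<close> and \<^term>\<open>f\<close> reveals one of the four
  pairs involved.  The junk value for degree and jump queries is harmless because their answers
  never change.
\<close>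

fun probed_pair :: "adj_lists \<Rightarrow> query \<Rightarrow> nat \<times> nat" where
  "probed_pair L (OUT w i) = (w, out_list L w ! (i - 1))"
| "probed_pair L (IN w i) = (in_list L w ! (i - 1), w)"
| "probed_pair L (IN_SORTED w i) = (in_sorted_list L w ! (i - 1), w)"
| "probed_pair L (ADJ u v) = (u, v)"
| "probed_pair L _ = undefined"

text \<open>For a position outside the list \<open>xs ! (i - 1)\<close> is a junk value, but then
  both sides are \<open>No_Such_Node\<close>.\<close>

lemma entry_map_fixpoint: "f (xs ! (i - 1)) = xs ! (i - 1) \<Longrightarrow> entry (map f xs) i = entry xs i"
  by (auto simp: entry_def)

text \<open>A list entry whose pair is none of the four is fixed by the transposition applied to its
  list, and adjacency differs only at these pairs. Degrees and the node set stay the same.\<close>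

lemma response_swap:
  assumes "swappable G e f" and q: "probed_pair L q \<notin> {e, f, (fst e, snd f), (fst f, snd e)}"
  shows "response (swap_arcs G e f) (swap_lists L e f) q = response G L q"
proof (cases q)
  case (OUT w i)
  then show ?thesis
    using q by (cases e; cases f) (auto simp: swap_lists_def intro!: entry_map_fixpoint transpose_apply_other)
next
  case (IN w i)
  then show ?thesis
    using q by (cases e; cases f) (auto simp: swap_lists_def intro!: entry_map_fixpoint transpose_apply_other)
next
  case (IN_SORTED w i)
  then show ?thesis
    using q by (cases e; cases f) (auto simp: swap_lists_def intro!: entry_map_fixpoint transpose_apply_other)
next
  case (ADJ u v)
  then show ?thesis
    using q by (auto simp: swap_arcs_def)
next
  case JUMP
  then show ?thesis
    by (simp add: swap_arcs_def)
qed (simp_all add: assms out_degree_eq_card in_degree_eq_card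
  card_out_neighbours_swap_arcs card_in_neighbours_swap_arcs)

text \<open>The pair \<open>p\<close> can occur in four roles. As one of the two arcs it leaves the
  other arc free; as a crossing pair it leaves one endpoint of each arc free. Each role thus admits
  at most \<open>card U * card V\<close> swaps.\<close>

lemma card_detecting_swaps:
  assumes "finite U" "finite V" "finite U'" "finite V'" "card U' = card U" "card V' = card V"
  shows "card {i \<in> (U \<times> V) \<times> (U' \<times> V').
      p \<in> {fst i, snd i, (fst (fst i), snd (snd i)), (fst (snd i), snd (fst i))}}
    \<le> 4 * (card U * card V)" (is "card ?D \<le> _")
proof -
  let ?D1 = "{p} \<times> (U' \<times> V')" and ?D2 = "(U \<times> V) \<times> {p}"
  let ?D3 = "(\<lambda>(v, u'). ((fst p, v), (u', snd p))) ` (V \<times> U')"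
  let ?D4 = "(\<lambda>(u, v'). ((u, snd p), (fst p, v'))) ` (U \<times> V')"
  have "?D \<subseteq> ?D1 \<union> ?D2 \<union> (?D3 \<union> ?D4)"
    by (cases p) (auto simp: image_iff)
  then have "card ?D \<le> card (?D1 \<union> ?D2 \<union> (?D3 \<union> ?D4))"
    using assms by (intro card_mono) auto
  also have "\<dots> \<le> (card ?D1 + card ?D2) + (card ?D3 + card ?D4)"
    by (intro order_trans[OF card_Un_le] add_mono card_Un_le)
  also have "\<dots> \<le> (card ({p} \<times> (U' \<times> V')) + card ((U \<times> V) \<times> {p})) + (card (V \<times> U') + card (U \<times> V'))"
    using assms by (intro add_mono card_image_le order_refl) auto
  also have "\<dots> = 4 * (card U * card V)"
    using assms by (simp add: card_cartesian_product)
  finally show ?thesis .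
qed

section \<open>Correctness forces detection\<close>

lemma solves_single_pairD:
  assumes "solves_single_pair \<alpha> \<epsilon> p\<^sub>f A" "sinkless_digraph G" "adj_lists_of G L"
    "s \<in> pverts G" "t \<in> pverts G" "0 < \<delta>" "\<delta> \<le> 1"
  shows "measure_pmf.prob (exec G L (A s t \<delta>))
    {r. case r of None \<Rightarrow> True
      | Some (x, \<tau>) \<Rightarrow> \<bar>x - ppr \<alpha> G s t\<bar> \<ge> \<epsilon> * max (ppr \<alpha> G s t) \<delta>} \<le> p\<^sub>f"
  using assms unfolding solves_single_pair_def by blast

text \<open>For the value 0 the tolerance is \<open>\<epsilon> * \<delta>\<close>, so every output
  from that threshold on is a failure.\<close>

lemma prob_large_output_le:
  assumes "solves_single_pair \<alpha> \<epsilon> p\<^sub>f A" "sinkless_digraph G" "adj_lists_of G L"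
    "s \<in> pverts G" "t \<in> pverts G" "0 < \<delta>" "\<delta> \<le> 1" "ppr \<alpha> G s t = 0"
  shows "measure_pmf.prob (exec G L (A s t \<delta>)) {r. \<exists>x \<tau>. r = Some (x, \<tau>) \<and> x \<in> {\<epsilon> * \<delta>..}} \<le> p\<^sub>f"
  by (rule order_trans[OF measure_pmf.finite_measure_mono solves_single_pairD[OF assms(1-7)]])
    (use assms in auto)

text \<open>The assumption \<open>le\<close> places the whole admissible error interval above the
  same threshold, so only failures fall below it.\<close>

lemma prob_large_output_ge:
  assumes "solves_single_pair \<alpha> \<epsilon> p\<^sub>f A" "sinkless_digraph G" "adj_lists_of G L"
    "s \<in> pverts G" "t \<in> pverts G" "0 < \<delta>" "\<delta> \<le> 1"
    and \<epsilon>: "0 < \<epsilon>" and le: "\<epsilon> * max (ppr \<alpha> G s t) \<delta> \<le> ppr \<alpha> G s t - \<epsilon> * \<delta>"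
  shows "1 - p\<^sub>f \<le> measure_pmf.prob (exec G L (A s t \<delta>)) {r. \<exists>x \<tau>. r = Some (x, \<tau>) \<and> x \<in> {\<epsilon> * \<delta>..}}"
proof -
  let ?p = "exec G L (A s t \<delta>)"
  let ?B = "{r. case r of None \<Rightarrow> True
      | Some (x, \<tau>) \<Rightarrow> \<bar>x - ppr \<alpha> G s t\<bar> \<ge> \<epsilon> * max (ppr \<alpha> G s t) \<delta>}"
  have "1 - p\<^sub>f \<le> 1 - measure_pmf.prob ?p ?B"
    using solves_single_pairD[OF assms(1-7)] by simp
  also have "\<dots> = measure_pmf.prob ?p (UNIV - ?B)"
    using measure_pmf.prob_compl[of ?B ?p] by simp
  also have "\<dots> \<le> measure_pmf.prob ?p {r. \<exists>x \<tau>. r = Some (x, \<tau>) \<and> x \<in> {\<epsilon> * \<delta>..}}"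
    using le by (intro measure_pmf.finite_measure_mono) (auto split: option.splits)
  finally show ?thesis .
qed

text \<open>Summing the coupling bound over all swaps gives
  \<open>B * B * (1 - p\<^sub>f) \<le> B * B * p\<^sub>f + 4 * B * E\<close>, where
  \<open>B = card U * card V\<close> and \<open>E\<close> is the expected time; then divide by
  \<open>4 * B\<close>.\<close>

lemma expected_time_ge_of_swaps:
  fixes U V U' V' :: "nat set"
  assumes "finite U" "finite V" "finite U'" "finite V'" "card U' = card U" "card V' = card V"
    and U: "U \<noteq> {}" and V: "V \<noteq> {}"
    and swappable: "\<And>e f. e \<in> U \<times> V \<Longrightarrow> f \<in> U' \<times> V' \<Longrightarrow> swappable G e f"
    and A: "solves_single_pair \<alpha> \<epsilon> p\<^sub>f A" and G: "sinkless_digraph G" and L: "adj_lists_of G L"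
    and st: "s \<in> pverts G" "t \<in> pverts G" and \<delta>: "0 < \<delta>" "\<delta> \<le> 1"
    and \<epsilon>: "0 < \<epsilon>" and p\<^sub>f: "0 \<le> p\<^sub>f" "p\<^sub>f \<le> 1"
    and zero: "ppr \<alpha> G s t = 0"
    and large: "\<And>e f. e \<in> U \<times> V \<Longrightarrow> f \<in> U' \<times> V' \<Longrightarrow>
      \<epsilon> * max (ppr \<alpha> (swap_arcs G e f) s t) \<delta> \<le> ppr \<alpha> (swap_arcs G e f) s t - \<epsilon> * \<delta>"
  shows "ennreal ((1 - 2 * p\<^sub>f) / 4 * real (card U * card V)) \<le> expected_time G L (A s t \<delta>)"
proof -
  let ?c = "A s t \<delta>" and ?X = "{\<epsilon> * \<delta>..}" and ?E = "expected_time G L (A s t \<delta>)"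
  define B where "B = card U * card V"
  define I where "I = (U \<times> V) \<times> (U' \<times> V')"
  \<comment> \<open>A position out of range yields a junk pair and may be counted as detecting; the
    count of affected swaps holds for every pair, so no harm is done.\<close>
  define Q where "Q i = {q. probed_pair L q \<in>
    {fst i, snd i, (fst (fst i), snd (snd i)), (fst (snd i), snd (fst i))}}" for i
  define G' where "G' i = swap_arcs G (fst i) (snd i)" for i
  define L' where "L' i = swap_lists L (fst i) (snd i)" for i
  have finI: "finite I" and cardI: "card I = B * B"
    using assms(1-6) by (auto simp: I_def B_def card_cartesian_product)
  have "0 < B"
    using assms(1,2) U V by (simp add: B_def card_gt_0_iff)
  have small: "emeasure (measure_pmf (exec G L ?c)) (halts_within k ?X) \<le> ennreal p\<^sub>f" for k
  proof -
    have "measure_pmf.prob (exec G L ?c) (halts_within k ?X)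
      \<le> measure_pmf.prob (exec G L ?c) {r. \<exists>x \<tau>. r = Some (x, \<tau>) \<and> x \<in> ?X}"
      by (intro measure_pmf.finite_measure_mono) (auto simp: halts_within_def)
    also have "\<dots> \<le> p\<^sub>f"
      by (rule prob_large_output_le) fact+
    finally show ?thesis
      by (simp add: measure_pmf.emeasure_eq_measure ennreal_leI)
  qed
  have large': "ennreal (1 - p\<^sub>f) \<le>
    (SUP k. emeasure (measure_pmf (exec (G' i) (L' i) ?c)) (halts_within k ?X))" if "i \<in> I" for i
  proof -
    have i: "fst i \<in> U \<times> V" "snd i \<in> U' \<times> V'"
      using that by (auto simp: I_def)
    have "1 - p\<^sub>f \<le> measure_pmf.prob (exec (G' i) (L' i) ?c) {r. \<exists>x \<tau>. r = Some (x, \<tau>) \<and> x \<in> ?X}"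
      unfolding G'_def L'_def
      using sinkless_digraph_swap_arcs[OF swappable[OF i] G] adj_lists_of_swap[OF swappable[OF i] L] st
      by (intro prob_large_output_ge[OF A] large i \<delta> \<epsilon>) (auto simp: swap_arcs_def)
    then show ?thesis
      unfolding emeasure_halts_eq_SUP[symmetric] by (simp add: measure_pmf.emeasure_eq_measure ennreal_leI)
  qed
  have "ennreal (real (B * B) * (1 - p\<^sub>f)) = (\<Sum>i\<in>I. ennreal (1 - p\<^sub>f))"
    using p\<^sub>f by (simp add: cardI ennreal_mult' ennreal_of_nat_eq_real_of_nat)
  also have "\<dots> \<le> (\<Sum>i\<in>I. SUP k. emeasure (measure_pmf (exec (G' i) (L' i) ?c)) (halts_within k ?X))"
    by (intro sum_mono large')
  \<comment> \<open>The probabilities increase with \<open>k\<close>, so the supremum moves out of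
    the finite sum and a bound uniform in \<open>k\<close> suffices.\<close>
  also have "\<dots> = (SUP k. \<Sum>i\<in>I. emeasure (measure_pmf (exec (G' i) (L' i) ?c)) (halts_within k ?X))"
    by (intro ennreal_SUP_sum[symmetric])
      (auto simp: incseq_def halts_within_def intro!: emeasure_mono)
  also have "\<dots> \<le> ennreal (real (B * B) * p\<^sub>f) + of_nat (4 * B) * ?E"
  proof (rule SUP_least)
    fix k
    have "(\<Sum>i\<in>I. emeasure (measure_pmf (exec (G' i) (L' i) ?c)) (halts_within k ?X))
        \<le> (\<Sum>i\<in>I. emeasure (measure_pmf (exec G L ?c)) (halts_within k ?X) + detection G L (Q i) k ?c)"
      by (intro sum_mono exec_le_exec_plus_detection)
        (auto simp: I_def Q_def G'_def L'_def intro!: response_swap swappable)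
    also have "\<dots> \<le> (\<Sum>i\<in>I. ennreal p\<^sub>f) + (\<Sum>i\<in>I. detection G L (Q i) k ?c)"
      by (simp only: sum.distrib) (intro add_mono sum_mono small order_refl)
    also have "\<dots> \<le> ennreal (real (B * B) * p\<^sub>f) + of_nat (4 * B) * ?E"
    proof (rule add_mono)
      show "(\<Sum>i\<in>I. ennreal p\<^sub>f) \<le> ennreal (real (B * B) * p\<^sub>f)"
        using p\<^sub>f by (simp add: cardI ennreal_mult' ennreal_of_nat_eq_real_of_nat)
      have "card {i \<in> I. q \<in> Q i} \<le> 4 * B" for q
        using card_detecting_swaps[OF assms(1-6), of "probed_pair L q"]
        by (simp add: I_def Q_def B_def)
      then show "(\<Sum>i\<in>I. detection G L (Q i) k ?c) \<le> of_nat (4 * B) * ?E"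
        by (intro sum_detection_le finI)
    qed
    finally show "(\<Sum>i\<in>I. emeasure (measure_pmf (exec (G' i) (L' i) ?c)) (halts_within k ?X)) \<le> \<dots>" .
  qed
  finally have main: "ennreal (real (B * B) * (1 - p\<^sub>f)) \<le> ennreal (real (B * B) * p\<^sub>f) + of_nat (4 * B) * ?E" .
  show ?thesis
  \<comment> \<open>An infinite expectation satisfies the bound trivially; a finite one allows
    subtraction and division in the reals.\<close>
  proof (cases ?E)
    case (real x)
    then have "of_nat (4 * B) * ?E = ennreal (real (4 * B) * x)"
      by (simp only: ennreal_of_nat_eq_real_of_nat ennreal_mult'[symmetric] of_nat_0_le_iff)
    with main real p\<^sub>f have "real (B * B) * (1 - p\<^sub>f) \<le> real (B * B) * p\<^sub>f + real (4 * B) * x"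
      by (simp del: of_nat_mult flip: ennreal_plus)
    then have "real B * ((1 - 2 * p\<^sub>f) / 4 * real B) \<le> real B * x"
      by (simp add: algebra_simps)
    then have "(1 - 2 * p\<^sub>f) / 4 * real B \<le> x"
      using \<open>0 < B\<close> by simp
    then show ?thesis
      using real by (simp add: B_def ennreal_leI del: of_nat_mult)
  qed simp
qed

section \<open>Averaging over sources and targets\<close>

lemma average_expected_time_ge:
  assumes "finite (pverts G)" "S \<subseteq> pverts G" "T \<subseteq> pverts G" "0 \<le> b"
    and b: "\<And>s t. s \<in> S \<Longrightarrow> t \<in> T \<Longrightarrow> ennreal b \<le> expected_time G L (A s t \<delta>)"
    and "0 < card (pverts G)"
  shows "ennreal (real (card S) * real (card T) * b / real (card (pverts G)) ^ 2)
    \<le> average_expected_time G L A \<delta>"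
proof -
  let ?k = "card (pverts G) ^ 2"
  have "ennreal (real (card S) * real (card T) * b) = (\<Sum>s\<in>S. \<Sum>t\<in>T. ennreal b)"
    using \<open>0 \<le> b\<close> by (simp add: ennreal_mult' ennreal_of_nat_eq_real_of_nat mult.assoc)
  also have "\<dots> \<le> (\<Sum>s\<in>S. \<Sum>t\<in>T. expected_time G L (A s t \<delta>))"
    by (intro sum_mono b)
  also have "\<dots> \<le> (\<Sum>s\<in>S. \<Sum>t\<in>pverts G. expected_time G L (A s t \<delta>))"
    using assms(1,3) by (intro sum_mono sum_mono2) auto
  also have "\<dots> \<le> (\<Sum>s\<in>pverts G. \<Sum>t\<in>pverts G. expected_time G L (A s t \<delta>))"
    using assms(1,2) by (intro sum_mono2) auto
  finally have "ennreal (real (card S) * real (card T) * b) / of_nat ?k \<le> average_expected_time G L A \<delta>"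
    unfolding average_expected_time_def by (rule divide_right_mono_ennreal)
  moreover have "ennreal (real (card S) * real (card T) * b) / of_nat ?k
      = ennreal (real (card S) * real (card T) * b / real ?k)"
    unfolding ennreal_of_nat_eq_real_of_nat
    using \<open>0 < card (pverts G)\<close> \<open>0 \<le> b\<close> by (intro divide_ennreal) auto
  ultimately show ?thesis
    by simp
qed

section \<open>The hard graph\<close>

text \<open>Digraphs live on the natural numbers; the injection \<open>to_nat\<close> allows a
  description by a datatype with named layers.\<close>

definition encode_digraph :: "'a::countable set \<Rightarrow> ('a \<times> 'a) set \<Rightarrow> nat pair_pre_digraph" where
  "encode_digraph V E = \<lparr>pverts = to_nat ` V, parcs = map_prod to_nat to_nat ` E\<rparr>"

lemma pverts_encode_digraph [simp]: "pverts (encode_digraph V E) = to_nat ` V"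
  by (simp add: encode_digraph_def)

lemma in_parcs_encode_digraph_iff [simp]:
  "(to_nat x, to_nat y) \<in> parcs (encode_digraph V E) \<longleftrightarrow> (x, y) \<in> E"
  by (auto simp: encode_digraph_def)

lemma card_pverts_encode_digraph: "card (pverts (encode_digraph V E)) = card V"
  by (simp add: card_image)

lemma card_parcs_encode_digraph: "card (parcs (encode_digraph V E)) = card E"
  unfolding encode_digraph_def pair_pre_digraph.simps by (rule card_image) (auto simp: inj_on_def)

lemma out_neighbours_encode_digraph:
  "out_neighbours (encode_digraph V E) (to_nat x) = to_nat ` (E `` {x})"
  by (auto simp: out_neighbours_def encode_digraph_def)

lemma sinkless_encode_digraph:
  assumes "finite V" "finite E" "\<And>x y. (x, y) \<in> E \<Longrightarrow> x \<in> V \<and> y \<in> V" "\<And>x. x \<in> V \<Longrightarrow> \<exists>y. (x, y) \<in> E"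
  shows "sinkless_digraph (encode_digraph V E)"
  unfolding sinkless_digraph_iff
proof (intro conjI ballI)
  fix u assume "u \<in> pverts (encode_digraph V E)"
  then obtain x where x: "u = to_nat x" "x \<in> V" by auto
  with assms(4) have "E `` {x} \<noteq> {}" by blast
  then show "out_neighbours (encode_digraph V E) u \<noteq> {}"
    by (simp add: x out_neighbours_encode_digraph)
qed (use assms in \<open>auto simp: encode_digraph_def\<close>)

text \<open>
  A walk goes from a source through the hub to group 0, in which it stays.  Each group \<^term>\<open>i\<close> is a
  complete bipartite graph from \<^term>\<open>Upper i\<close> (size \<^term>\<open>h\<close>) to \<^term>\<open>Middle i\<close> (size \<^term>\<open>g\<close>)
  followed by one from \<^term>\<open>Middle i\<close> to \<^term>\<open>Target i\<close> (size \<^term>\<open>h\<close>).  The nodes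
  \<^term>\<open>Pad j\<close>, detached from the rest, only serve to bring the number of arcs up to \<^term>\<open>m\<close>.
\<close>

datatype node = Source nat | Hub | Upper nat nat | Middle nat nat | Target nat nat | Pad nat

instance node :: countable
  by countable_datatype

text \<open>\<open>P\<close> holds the arcs among the pads: its diagonal gives every pad an
  out-neighbour, and its size gives the lower bound on the number of arcs. \<open>h \<le> n\<close>
  and \<open>g * n \<le> m\<close> keep the groups within O(n) nodes and O(m) arcs.\<close>

locale hard_graph =
  fixes n m g h :: nat and P :: "(nat \<times> nat) set"
  assumes g: "1 \<le> g" "g \<le> h" and h: "h \<le> n" and gn: "g * n \<le> m"
    and P: "P \<subseteq> {..<n} \<times> {..<n}" "Id_on {..<n} \<subseteq> P" "card P = m"
begin

text \<open>Groups are indexed from 0 to \<open>N\<close>, so \<open>N\<close> of them remain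
  besides group 0, with at least \<open>n / 2\<close> target nodes in total.\<close>

definition N :: nat where "N = n div h"

definition nodes :: "node set" where
  "nodes = Source ` {..<n} \<union> {Hub} \<union> case_prod Upper ` ({..N} \<times> {..<h}) \<union>
     case_prod Middle ` ({..N} \<times> {..<g}) \<union> case_prod Target ` ({..N} \<times> {..<h}) \<union> Pad ` {..<n}"

text \<open>The hub leads to group 0 only. The self-loops at \<open>Target\<close> nodes provide an
  out-neighbour without letting a walk leave its group.\<close>

definition arcs :: "(node \<times> node) set" where
  "arcs = (\<lambda>j. (Source j, Hub)) ` {..<n} \<union> (\<lambda>j. (Hub, Upper 0 j)) ` {..<h} \<union>
     (\<lambda>(i, j, k). (Upper i j, Middle i k)) ` ({..N} \<times> {..<h} \<times> {..<g}) \<union>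
     (\<lambda>(i, k, j). (Middle i k, Target i j)) ` ({..N} \<times> {..<g} \<times> {..<h}) \<union>
     (\<lambda>(i, j). (Target i j, Target i j)) ` ({..N} \<times> {..<h}) \<union> map_prod Pad Pad ` P"

definition G :: "nat pair_pre_digraph" where
  "G = encode_digraph nodes arcs"

lemma finite_P: "finite P"
  using P(1) by (rule finite_subset) simp

lemma finite_nodes: "finite nodes"
  by (simp add: nodes_def)

lemma finite_arcs: "finite arcs"
  by (simp add: arcs_def finite_P)

lemma h_pos: "0 < h" and n_pos: "0 < n"
  using g h by auto

text \<open>The remainder of the division is below \<open>h \<le> N * h\<close>, so rounding loses
  at most a factor 2.\<close>

lemma group_sizes: "N * h \<le> n" "1 \<le> N" "n \<le> 2 * (N * h)"
proof -
  show "N * h \<le> n" by (simp add: N_def)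
  show N: "1 \<le> N" using h h_pos by (simp add: N_def Suc_le_eq div_greater_zero_iff)
  have "n = N * h + n mod h" by (simp add: N_def)
  moreover have "n mod h < h" using h_pos by simp
  moreover have "h \<le> N * h" using N by simp
  ultimately show "n \<le> 2 * (N * h)" by linarith
qed

lemma groups_le: "(N + 1) * h \<le> 2 * n"
  using group_sizes h by simp

lemma sinkless: "sinkless_digraph G"
  unfolding G_def
proof (rule sinkless_encode_digraph)
  show "x \<in> nodes \<and> y \<in> nodes" if "(x, y) \<in> arcs" for x y
    using that P(1) h_pos n_pos by (auto simp: arcs_def nodes_def)
  show "\<exists>y. (x, y) \<in> arcs" if "x \<in> nodes" for x
  proof (cases x)
    case Hub
    then show ?thesis using h_pos by (auto simp: arcs_def intro!: exI[of _ "Upper 0 0"])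
  next
    case (Upper i j)
    then show ?thesis using that g by (auto simp: arcs_def nodes_def image_iff intro!: exI[of _ "Middle i 0"])
  next
    case (Middle i k)
    then show ?thesis using that h_pos by (auto simp: arcs_def nodes_def image_iff intro!: exI[of _ "Target i 0"])
  next
    case (Pad j)
    then have "(j, j) \<in> P" using that P(2) by (auto simp: nodes_def)
    then show ?thesis using Pad by (auto simp: arcs_def intro!: exI[of _ "Pad j"])
  qed (use that in \<open>auto simp: arcs_def nodes_def\<close>)
qed (simp_all add: finite_nodes finite_arcs)

lemma card_pverts_ge: "n \<le> card (pverts G)"
proof -
  have "n = card (Source ` {..<n})" by (simp add: card_image inj_on_def)
  also have "\<dots> \<le> card nodes" using finite_nodes by (intro card_mono) (auto simp: nodes_def)
  finally show ?thesis unfolding G_def card_pverts_encode_digraph .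
qed

text \<open>The three layers have at most \<open>2 * n\<close> nodes each, sources and pads
  \<open>n\<close> each; with the hub this makes \<open>8 * n + 1\<close>.\<close>

lemma card_pverts_le: "card (pverts G) \<le> 9 * n"
proof -
  have "card nodes \<le> card (Source ` {..<n}) + card {Hub} + card (case_prod Upper ` ({..N} \<times> {..<h})) +
     card (case_prod Middle ` ({..N} \<times> {..<g})) + card (case_prod Target ` ({..N} \<times> {..<h})) +
     card (Pad ` {..<n})"
    unfolding nodes_def by (intro order_trans[OF card_Un_le] add_mono order_refl)
  also have "\<dots> \<le> card {..<n} + 1 + card ({..N} \<times> {..<h}) + card ({..N} \<times> {..<g}) +
      card ({..N} \<times> {..<h}) + card {..<n}"
    by (intro add_mono card_image_le) auto
  also have "\<dots> = n + 1 + (N + 1) * h + (N + 1) * g + (N + 1) * h + n"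
    by (simp add: card_cartesian_product)
  also have "(N + 1) * g \<le> (N + 1) * h"
    using g(2) by (rule mult_le_mono2)
  finally show ?thesis
    unfolding G_def card_pverts_encode_digraph using groups_le n_pos by linarith
qed

lemma card_parcs_ge: "m \<le> card (parcs G)"
proof -
  have "m = card (map_prod Pad Pad ` P)"
    by (subst card_image) (auto simp: P inj_on_def)
  also have "\<dots> \<le> card arcs" using finite_arcs by (intro card_mono) (auto simp: arcs_def)
  finally show ?thesis by (simp add: G_def card_parcs_encode_digraph)
qed

text \<open>In units of \<open>m\<close>: 1 for the sources, 1 for the hub, 2 for each of the two
  bipartite layers, 2 for the self-loops and 1 for the pads.\<close>

lemma card_parcs_le: "card (parcs G) \<le> 9 * m"
proof -
  have "card arcs \<le> card ((\<lambda>j. (Source j, Hub)) ` {..<n}) + card ((\<lambda>j. (Hub, Upper 0 j)) ` {..<h}) +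
     card ((\<lambda>(i, j, k). (Upper i j, Middle i k)) ` ({..N} \<times> {..<h} \<times> {..<g})) +
     card ((\<lambda>(i, k, j). (Middle i k, Target i j)) ` ({..N} \<times> {..<g} \<times> {..<h})) +
     card ((\<lambda>(i, j). (Target i j, Target i j)) ` ({..N} \<times> {..<h})) + card (map_prod Pad Pad ` P)"
    unfolding arcs_def by (intro order_trans[OF card_Un_le] add_mono order_refl)
  also have "\<dots> \<le> card {..<n} + card {..<h} + card ({..N} \<times> {..<h} \<times> {..<g}) +
      card ({..N} \<times> {..<g} \<times> {..<h}) + card ({..N} \<times> {..<h}) + card P"
    by (intro add_mono card_image_le) (auto simp: finite_P)
  also have "\<dots> = n + h + 2 * (g * ((N + 1) * h)) + (N + 1) * h + m"
    by (simp add: card_cartesian_product P algebra_simps)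
  also have "g * ((N + 1) * h) \<le> g * (2 * n)"
    using groups_le by (intro mult_left_mono) auto
  also have "g * (2 * n) = 2 * (g * n)"
    by simp
  finally have "card arcs \<le> n + h + 2 * (2 * (g * n)) + (N + 1) * h + m"
    by simp
  moreover have "n \<le> m"
    using gn g(1) by (metis mult_le_mono1 nat_mult_1 order_trans)
  ultimately show ?thesis
    using gn h groups_le by (simp add: G_def card_parcs_encode_digraph)
qed

lemma arcs_Image:
  "j < n \<Longrightarrow> arcs `` {Source j} = {Hub}"
  "arcs `` {Hub} = Upper 0 ` {..<h}"
  "i \<le> N \<Longrightarrow> j < h \<Longrightarrow> arcs `` {Upper i j} = Middle i ` {..<g}"
  "i \<le> N \<Longrightarrow> k < g \<Longrightarrow> arcs `` {Middle i k} = Target i ` {..<h}"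
  by (auto simp: arcs_def image_iff)

definition uppers :: "nat \<Rightarrow> nat set" where
  "uppers i = (\<lambda>j. to_nat (Upper i j)) ` {..<h}"

definition middles :: "nat \<Rightarrow> nat set" where
  "middles i = (\<lambda>k. to_nat (Middle i k)) ` {..<g}"

definition sources :: "nat set" where
  "sources = (\<lambda>j. to_nat (Source j)) ` {..<n}"

text \<open>Group 0 is left out because the sources reach it.\<close>

definition targets :: "nat set" where
  "targets = (\<lambda>(i, j). to_nat (Target i j)) ` ({1..N} \<times> {..<h})"

lemma card_uppers: "card (uppers i) = h"
  by (simp add: uppers_def card_image inj_on_def)

lemma card_middles: "card (middles i) = g"
  by (simp add: middles_def card_image inj_on_def)

lemma card_sources: "card sources = n"
  by (simp add: sources_def card_image inj_on_def)

lemma card_targets: "card targets = N * h"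
  unfolding targets_def by (subst card_image) (auto simp: inj_on_def)

lemma sources_subset: "sources \<subseteq> pverts G"
  by (auto simp: sources_def G_def nodes_def)

lemma targets_subset: "targets \<subseteq> pverts G"
proof -
  have "Target i j \<in> nodes" if "i \<le> N" "j < h" for i j
    using that by (force simp: nodes_def)
  then show ?thesis by (auto simp: targets_def G_def)
qed

text \<open>No arc joins different groups, and all upper nodes have out-degree
  \<open>g\<close>.\<close>

lemma swappable_groups:
  assumes "e \<in> uppers 0 \<times> middles 0" "f \<in> uppers i \<times> middles i" "1 \<le> i" "i \<le> N"
  shows "swappable G e f"
proof -
  obtain j k j' k' where ef: "e = (to_nat (Upper 0 j), to_nat (Middle 0 k))"
      "f = (to_nat (Upper i j'), to_nat (Middle i k'))" "j < h" "k < g" "j' < h" "k' < g"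
    using assms by (auto simp: uppers_def middles_def)
  have "(Upper 0 j, Middle 0 k) \<in> arcs" "(Upper i j', Middle i k') \<in> arcs"
    "(Upper 0 j, Middle i k') \<notin> arcs" "(Upper i j', Middle 0 k) \<notin> arcs"
    using ef assms by (auto simp: arcs_def image_iff)
  then show ?thesis
    using ef assms
    by (simp add: swappable_def G_def out_neighbours_encode_digraph arcs_Image card_image inj_on_def)
qed

text \<open>Sources, hub and group 0 form a set that is closed under arcs and contains no target of
  another group.\<close>

lemma ppr_eq_0_groups:
  assumes "0 < \<alpha>" "\<alpha> \<le> 1" "s \<in> sources" "t \<in> targets"
  shows "ppr \<alpha> G s t = 0"
proof (rule ppr_eq_0[OF assms(1,2)])
  let ?C = "range Source \<union> {Hub} \<union> range (Upper 0) \<union> range (Middle 0) \<union> range (Target 0)"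
  show "out_neighbours G u \<subseteq> to_nat ` ?C" if u: "u \<in> to_nat ` ?C" for u
  proof -
    obtain x where x: "u = to_nat x" "x \<in> ?C" using u by blast
    then have "arcs `` {x} \<subseteq> ?C" by (auto simp: arcs_def)
    then show ?thesis unfolding x(1) G_def out_neighbours_encode_digraph by (rule image_mono)
  qed
  show "t \<notin> to_nat ` ?C"
    using assms by (auto simp: targets_def)
  show "s \<in> to_nat ` ?C"
    using assms by (auto simp: sources_def)
qed

text \<open>The swap opens the path \<open>s\<close>, \<open>Hub\<close>, \<open>Upper 0 j\<close>,
  \<open>Middle i k'\<close>, \<open>t\<close>, whose first four nodes have out-degrees 1,
  \<open>h\<close>, \<open>g\<close>, \<open>h\<close>. Four moves and one stop contribute
  \<open>\<alpha> * (1 - \<alpha>) ^ 4\<close>.\<close>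

lemma ppr_swap_ge:
  assumes \<alpha>: "0 < \<alpha>" "\<alpha> < 1" and s: "s \<in> sources"
    and t: "t = to_nat (Target i l)" "l < h" and i: "1 \<le> i" "i \<le> N"
    and e: "e \<in> uppers 0 \<times> middles 0" and f: "f \<in> uppers i \<times> middles i"
  shows "\<alpha> * (1 - \<alpha>) ^ 4 / (real g * real h ^ 2) \<le> ppr \<alpha> (swap_arcs G e f) s t"
proof -
  let ?G = "swap_arcs G e f"
  obtain j k j' k' where ef: "e = (to_nat (Upper 0 j), to_nat (Middle 0 k))"
      "f = (to_nat (Upper i j'), to_nat (Middle i k'))" "j < h" "k < g" "j' < h" "k' < g"
    using e f by (auto simp: uppers_def middles_def)
  obtain a where a: "s = to_nat (Source a)" "a < n" using s by (auto simp: sources_def)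
  have swp: "swappable G e f" using swappable_groups e f i by blast
  have fin: "finite (out_neighbours ?G w)" for w
    using sinkless_digraph_swap_arcs[OF swp sinkless] by (simp add: sinkless_digraph_iff finite_out_neighbours)
  note nbr = G_def out_neighbours_encode_digraph arcs_Image ef
  have c: "card (out_neighbours ?G (to_nat (Middle i k'))) = h"
      "card (out_neighbours ?G (to_nat (Upper 0 j))) = g"
      "card (out_neighbours ?G (to_nat Hub)) = h"
      "card (out_neighbours ?G s) = 1"
    unfolding card_out_neighbours_swap_arcs[OF swp] using a ef i
    by (simp_all add: nbr card_image inj_on_def)
  note step = ppr_ge_step[OF less_imp_le[OF \<alpha>(1)] less_imp_le[OF \<alpha>(2)] fin]
  have "\<alpha> \<le> ppr \<alpha> ?G t t" using \<alpha> by (intro ppr_self_ge) auto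
  moreover have "t \<in> out_neighbours ?G (to_nat (Middle i k'))"
    unfolding out_neighbours_swap_arcs[OF swp] using ef i t by (simp add: nbr)
  ultimately have "(1 - \<alpha>) * (\<alpha> / h) \<le> ppr \<alpha> ?G (to_nat (Middle i k')) t"
    using step c by metis
  moreover have "to_nat (Middle i k') \<in> out_neighbours ?G (to_nat (Upper 0 j))"
    using ef by (auto simp: out_neighbours_def swap_arcs_def)
  ultimately have "(1 - \<alpha>) * ((1 - \<alpha>) * (\<alpha> / h) / g) \<le> ppr \<alpha> ?G (to_nat (Upper 0 j)) t"
    using step c by metis
  moreover have "to_nat (Upper 0 j) \<in> out_neighbours ?G (to_nat Hub)"
    unfolding out_neighbours_swap_arcs[OF swp] using ef by (simp add: nbr)
  ultimately have "(1 - \<alpha>) * ((1 - \<alpha>) * ((1 - \<alpha>) * (\<alpha> / h) / g) / h) \<le> ppr \<alpha> ?G (to_nat Hub) t"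
    using step c by metis
  moreover have "to_nat Hub \<in> out_neighbours ?G s"
    unfolding out_neighbours_swap_arcs[OF swp] using ef a by (simp add: nbr)
  ultimately have "(1 - \<alpha>) * ((1 - \<alpha>) * ((1 - \<alpha>) * ((1 - \<alpha>) * (\<alpha> / h) / g) / h) / real 1) \<le> ppr \<alpha> ?G s t"
    using step c by metis
  moreover have "(1 - \<alpha>) * ((1 - \<alpha>) * ((1 - \<alpha>) * ((1 - \<alpha>) * (\<alpha> / h) / g) / h) / real 1)
      = \<alpha> * (1 - \<alpha>) ^ 4 / (real g * real h ^ 2)"
    by (simp add: power2_eq_square power4_eq_xxxx mult_ac)
  ultimately show ?thesis by simp
qed

lemma expected_time_ge:
  assumes \<alpha>: "0 < \<alpha>" "\<alpha> < 1" and \<epsilon>: "0 < \<epsilon>" "\<epsilon> < 1" and p\<^sub>f: "0 \<le> p\<^sub>f" "p\<^sub>f \<le> 1"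
    and \<delta>: "0 < \<delta>" "\<delta> \<le> 1" "real g * real h ^ 2 \<le> \<alpha> * (1 - \<alpha>) ^ 4 * (1 - \<epsilon>) / \<delta>"
    and A: "solves_single_pair \<alpha> \<epsilon> p\<^sub>f A" and L: "adj_lists_of G L"
    and s: "s \<in> sources" and t: "t \<in> targets"
  shows "ennreal ((1 - 2 * p\<^sub>f) / 4 * real (h * g)) \<le> expected_time G L (A s t \<delta>)"
proof -
  obtain i l where i: "1 \<le> i" "i \<le> N" and l: "t = to_nat (Target i l)" "l < h"
    using t by (auto simp: targets_def)
  have pos: "0 < real g * real h ^ 2"
    using g h_pos by simp
  have "ennreal ((1 - 2 * p\<^sub>f) / 4 * real (card (uppers 0) * card (middles 0))) \<le> expected_time G L (A s t \<delta>)"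
  proof (rule expected_time_ge_of_swaps[where U' = "uppers i" and V' = "middles i"])
    fix e f assume e: "e \<in> uppers 0 \<times> middles 0" and f: "f \<in> uppers i \<times> middles i"
    show "swappable G e f" by (rule swappable_groups[OF e f i])
    let ?p = "ppr \<alpha> (swap_arcs G e f) s t"
    \<comment> \<open>A value of at least \<open>\<delta> / (1 - \<epsilon>)\<close> still leaves
      \<open>\<delta>\<close> after a relative error of \<open>\<epsilon>\<close>, and
      \<open>\<delta>\<close> is no less than the threshold
      \<open>\<epsilon> * \<delta>\<close>.\<close>
    have "\<delta> / (1 - \<epsilon>) \<le> \<alpha> * (1 - \<alpha>) ^ 4 / (real g * real h ^ 2)"
      using \<delta> \<epsilon> pos by (simp add: field_simps)
    also have "\<dots> \<le> ?p"
      by (rule ppr_swap_ge[OF \<alpha> s l i e f])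
    finally have 1: "\<delta> \<le> (1 - \<epsilon>) * ?p"
      using \<epsilon> by (simp add: field_simps)
    moreover have "(1 - \<epsilon>) * ?p \<le> ?p"
      using \<epsilon> ppr_nonneg[of \<alpha> "swap_arcs G e f" s t] by (simp add: algebra_simps)
    moreover have "\<epsilon> * \<delta> \<le> \<delta>"
      using \<epsilon> \<delta> by simp
    ultimately show "\<epsilon> * max ?p \<delta> \<le> ?p - \<epsilon> * \<delta>"
      by (simp add: max_absorb1 algebra_simps)
  next
    show "ppr \<alpha> G s t = 0" using \<alpha> s t by (intro ppr_eq_0_groups) auto
    show "s \<in> pverts G" "t \<in> pverts G" using s t sources_subset targets_subset by auto
    show "uppers 0 \<noteq> {}" "middles 0 \<noteq> {}" using h_pos g by (auto simp: uppers_def middles_def lessThan_empty_iff)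
  qed (use assms sinkless in \<open>simp_all add: card_uppers card_middles, simp_all add: uppers_def middles_def\<close>)
  then show ?thesis by (simp add: card_uppers card_middles)
qed

text \<open>There are \<open>n\<close> sources and at least \<open>n / 2\<close> targets among at
  most \<open>9 * n\<close> nodes, so at least one pair in 162 is hard, and 648 is 4 times
  162.\<close>

lemma average_expected_time_ge_groups:
  assumes "0 < \<alpha>" "\<alpha> < 1" "0 < \<epsilon>" "\<epsilon> < 1" "0 \<le> p\<^sub>f" "p\<^sub>f \<le> 1 / 2"
    and "0 < \<delta>" "\<delta> \<le> 1" "real g * real h ^ 2 \<le> \<alpha> * (1 - \<alpha>) ^ 4 * (1 - \<epsilon>) / \<delta>"
    and "solves_single_pair \<alpha> \<epsilon> p\<^sub>f A" and "adj_lists_of G L"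
  shows "ennreal ((1 - 2 * p\<^sub>f) / 648 * real (g * h)) \<le> average_expected_time G L A \<delta>"
proof -
  define b where "b = (1 - 2 * p\<^sub>f) / 4 * real (h * g)"
  have b0: "0 \<le> b" using assms by (simp add: b_def)
  have "(1 - 2 * p\<^sub>f) / 648 * real (g * h) = real n * (real n / 2) * b / (9 * real n) ^ 2"
    using n_pos by (simp add: b_def power2_eq_square)
  also have "\<dots> \<le> real n * real (N * h) * b / (9 * real n) ^ 2"
  proof -
    have "real n / 2 \<le> real (N * h)" using group_sizes(3) by linarith
    then show ?thesis using b0 by (intro divide_right_mono mult_right_mono mult_left_mono) auto
  qed
  also have "\<dots> \<le> real n * real (N * h) * b / real (card (pverts G)) ^ 2"
    using card_pverts_le card_pverts_ge n_pos b0 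
    by (intro divide_left_mono power_mono mult_pos_pos) (auto simp flip: of_nat_mult)
  finally have "ennreal ((1 - 2 * p\<^sub>f) / 648 * real (g * h))
      \<le> ennreal (real (card sources) * real (card targets) * b / real (card (pverts G)) ^ 2)"
    unfolding card_sources card_targets by (rule ennreal_leI)
  also have "\<dots> \<le> average_expected_time G L A \<delta>"
    unfolding b_def using assms card_pverts_ge n_pos finite_nodes
    by (intro average_expected_time_ge sources_subset targets_subset expected_time_ge) (auto simp: G_def)
  finally show ?thesis .
qed

end

section \<open>Choice of the group sizes\<close>

lemma real_le_2_nat_floor:
  assumes "1 \<le> x"
  shows "x \<le> 2 * real (nat \<lfloor>x\<rfloor>)"
proof -
  have "1 \<le> \<lfloor>x\<rfloor>" using assms by (simp add: le_floor_iff)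
  then have "real (nat \<lfloor>x\<rfloor>) = real_of_int \<lfloor>x\<rfloor>" "1 \<le> real_of_int \<lfloor>x\<rfloor>" by simp_all
  then show ?thesis using real_of_int_floor_add_one_gt[of x] by linarith
qed

text \<open>
  Up to constants, \<^term>\<open>g\<close> is the minimum of \<^term>\<open>m / n\<close> and \<^term>\<open>D powr (1 / 3)\<close>, and \<^term>\<open>h\<close>
  is then as large as \<^term>\<open>h \<le> n\<close> and \<^term>\<open>g * h ^ 2 \<le> D\<close> permit.
\<close>

lemma exists_group_sizes:
  fixes n m :: nat and D :: real
  assumes n: "1 \<le> n" "n \<le> m" "m \<le> n ^ 2" and D: "1 \<le> D"
  shows "\<exists>g h. 1 \<le> g \<and> g \<le> h \<and> h \<le> n \<and> g * n \<le> m \<and> real g * real h ^ 2 \<le> D \<and>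
    min (real m) (min (sqrt (real m / real n * D)) (D powr (2 / 3))) \<le> 4 * real (g * h)"
proof -
  define y where "y = D powr (1 / 3)"
  have y: "1 \<le> y" "y ^ 3 = D" "D powr (2 / 3) = y ^ 2"
    using D by (auto simp: y_def ge_one_powr_ge_zero powr_powr simp flip: powr_realpow)
  define g where "g = min (nat \<lfloor>y\<rfloor>) (m div n)"
  have g1: "1 \<le> g"
    using y n by (auto simp: g_def le_nat_floor Suc_le_eq div_greater_zero_iff)
  have gy: "real g \<le> y"
    using y(1) by (simp add: g_def min_def) linarith
  have "g * n \<le> m div n * n" by (rule mult_le_mono1) (simp add: g_def)
  then have gn: "g * n \<le> m" using div_times_less_eq_dividend[of m n] by linarith
  have "m div n \<le> n"
    using n by (metis div_le_mono nonzero_mult_div_cancel_left not_one_le_zero power2_eq_square)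
  then have gle: "g \<le> n" by (simp add: g_def)
  define z where "z = sqrt (D / g)"
  have z2: "real g * z ^ 2 = D"
    using g1 D by (simp add: z_def)
  \<comment> \<open>This gives \<open>g ^ 2 \<le> D / g\<close>, so \<open>g\<close> does not exceed
    the ideal real value \<open>z\<close> of \<open>h\<close>, as needed for
    \<open>g \<le> h\<close>.\<close>
  have "real g ^ 3 \<le> y ^ 3" using gy by (intro power_mono) auto
  then have gz: "real g \<le> z"
    unfolding z_def using g1 y by (intro real_le_rsqrt) (simp add: field_simps power2_eq_square power3_eq_cube)
  then have z1: "1 \<le> z" using g1 by linarith
  define h where "h = min n (nat \<lfloor>z\<rfloor>)"
  have gh: "g \<le> h" using gle gz by (simp add: h_def le_nat_floor)
  have hz: "real h \<le> z" using z1 by (simp add: h_def min_def) linarith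
  have "real g * real h ^ 2 \<le> D"
    using hz z2 by (metis mult_left_mono of_nat_0_le_iff power_mono)
  moreover have "min (real m) (min (sqrt (real m / real n * D)) (D powr (2 / 3))) \<le> 4 * real (g * h)"
  proof -
    \<comment> \<open>Whichever argument attains the minimum in \<open>g\<close>, rounding it down
      costs at most a factor 2.\<close>
    have gyd: "y \<le> 2 * real g \<or> g = m div n"
      using real_le_2_nat_floor[OF y(1)] by (auto simp: g_def min_def)
    have mg: "m \<le> 2 * (g * n)" if "g = m div n"
    proof -
      have "m = g * n + m mod n" using that by simp
      moreover have "m mod n < n" using n by simp
      moreover have "n \<le> g * n" using g1 by simp
      ultimately show ?thesis by linarith
    qed
    show ?thesis
    \<comment> \<open>For \<open>h = n\<close> the term bounded is \<open>m\<close> or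
      \<open>D powr (2 / 3)\<close>, depending on which argument determines \<open>g\<close>;
      otherwise \<open>h\<close> is \<open>z\<close> rounded down, and it is the square root or
      again \<open>D powr (2 / 3)\<close>.\<close>
    proof (cases "h = n")
      case True
      from gyd show ?thesis
      proof
        assume "g = m div n"
        from mg[OF this] True have "real m \<le> 4 * real (g * h)"
          by (simp flip: of_nat_mult)
        then show ?thesis by linarith
      next
        assume "y \<le> 2 * real g"
        then have "y ^ 2 \<le> (2 * real g) ^ 2" using y by (intro power_mono) auto
        also have "\<dots> = 4 * (real g * real g)" by (simp add: power2_eq_square)
        also have "\<dots> \<le> 4 * real (g * h)" using gle True by (simp add: mult_left_mono)
        finally show ?thesis using y by linarith
      qed
    next
      case False
      then have "z \<le> 2 * real h"
        using real_le_2_nat_floor[OF z1] by (auto simp: h_def min_def split: if_splits)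
      then have "(real g * z) ^ 2 \<le> (real g * (2 * real h)) ^ 2"
        using z1 by (intro power_mono mult_left_mono) auto
      moreover have "(real g * z) ^ 2 = real g * D"
        by (simp add: power_mult_distrib power2_eq_square flip: z2)
      moreover have "2 * (real g * (2 * real h)) ^ 2 \<le> (4 * real (g * h)) ^ 2"
        by (simp add: power_mult_distrib)
      \<comment> \<open>The factor 2 on the left is reserved for the rounding of \<open>g\<close>:
        the two cases insert \<open>m / n \<le> 2 * g\<close> or
        \<open>y \<le> 2 * g\<close>.\<close>
      ultimately have key: "2 * real g * D \<le> (4 * real (g * h)) ^ 2"
        by linarith
      from gyd show ?thesis
      proof
        assume "g = m div n"
        from mg[OF this] have "real m \<le> 2 * real g * real n"
          by (metis mult.assoc of_nat_le_iff of_nat_mult of_nat_numeral)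
        then have "real m / real n * D \<le> 2 * real g * D"
          using n D by (intro mult_right_mono) (auto simp: field_simps)
        then have "real m / real n * D \<le> (4 * real (g * h)) ^ 2"
          using key by (rule order_trans)
        then have "sqrt (real m / real n * D) \<le> 4 * real (g * h)"
          by (rule real_le_lsqrt[rotated]) simp
        then show ?thesis by linarith
      next
        assume "y \<le> 2 * real g"
        then have "y * D \<le> 2 * real g * D" using D by (intro mult_right_mono) auto
        moreover have "(y ^ 2) ^ 2 = y * D"
          by (simp add: power2_eq_square power3_eq_cube flip: y(2))
        ultimately have "(y ^ 2) ^ 2 \<le> (4 * real (g * h)) ^ 2"
          using key by linarith
        then have "y ^ 2 \<le> 4 * real (g * h)"
          by (rule power2_le_imp_le) simp
        then show ?thesis using y by linarith
      qed
    qed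
  qed
  ultimately show ?thesis
    using g1 gh gn by (intro exI[of _ g] exI[of _ h]) (simp add: h_def)
qed

text \<open>The pad arcs are any set of size \<open>m\<close> between the diagonal and the full
  square, which exists because \<open>n \<le> m \<le> n ^ 2\<close>.\<close>

lemma exists_hard_graph:
  assumes "1 \<le> g" "g \<le> h" "h \<le> n" "g * n \<le> m" "m \<le> n ^ 2"
  shows "\<exists>P. hard_graph n m g h P"
proof -
  have "Id_on {..<n} = (\<lambda>x. (x, x)) ` {..<n}" by auto
  then have "card (Id_on {..<n}) = n" by (simp add: card_image inj_on_def)
  moreover have "n \<le> m" using mult_le_mono1[OF assms(1), of n] assms(4) by linarith
  ultimately have "\<exists>P. Id_on {..<n} \<subseteq> P \<and> P \<subseteq> {..<n} \<times> {..<n} \<and> card P = m"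
    using assms by (intro exists_subset_between) (auto simp: power2_eq_square)
  then show ?thesis
    using assms by (auto simp: hard_graph_def)
qed

section \<open>Assembling the lower bound\<close>

theorem theorem3p3:
  fixes \<alpha> \<epsilon> p\<^sub>f :: real
  assumes "0 < \<alpha>" and "\<alpha> < 1"
    and "0 < \<epsilon>" and "\<epsilon> < 1"
    and "0 < p\<^sub>f" and "p\<^sub>f < 1 / 2"
  shows "\<exists>a\<^sub>1 a\<^sub>2 b\<^sub>1 b\<^sub>2 c :: real. 0 < a\<^sub>1 \<and> 0 < a\<^sub>2 \<and> 0 < b\<^sub>1 \<and> 0 < b\<^sub>2 \<and> 0 < c \<and>
    (\<forall>(n::nat) (m::nat) (\<delta>::real). 1 \<le> n \<longrightarrow> n \<le> m \<longrightarrow> m \<le> n ^ 2 \<longrightarrow> 0 < \<delta> \<longrightarrow> \<delta> \<le> 1 \<longrightarrow>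
      (\<exists>G. sinkless_digraph G \<and>
        a\<^sub>1 * real n \<le> real (card (pverts G)) \<and> real (card (pverts G)) \<le> a\<^sub>2 * real n \<and>
        b\<^sub>1 * real m \<le> real (card (parcs G)) \<and> real (card (parcs G)) \<le> b\<^sub>2 * real m \<and>
        (\<forall>L A. adj_lists_of G L \<longrightarrow> solves_single_pair \<alpha> \<epsilon> p\<^sub>f A \<longrightarrow>
          (let d = real m / real n in
            ennreal (c * min (real m) (min ((d / \<delta>) powr (1 / 2)) ((1 / \<delta>) powr (2 / 3))))
              \<le> average_expected_time G L A \<delta>))))"
proof -
  \<comment> \<open>Swapped graphs have a large enough value as long as
    \<open>g * h ^ 2 \<le> \<kappa> / \<delta>\<close>.\<close>
  define \<kappa> where "\<kappa> = \<alpha> * (1 - \<alpha>) ^ 4 * (1 - \<epsilon>)"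
  \<comment> \<open>2592 is 648 from the averaging times 4 from the choice of \<open>g\<close> and
    \<open>h\<close>; the factor \<open>\<kappa>\<close> pays for replacing
    \<open>1 / \<delta>\<close> by \<open>\<kappa> / \<delta>\<close>.\<close>
  define c where "c = (1 - 2 * p\<^sub>f) * \<kappa> / 2592"
  have \<kappa>: "0 < \<kappa>" "\<kappa> \<le> 1"
    using assms by (auto simp: \<kappa>_def intro!: mult_le_one power_le_one)
  have c: "0 < c" "c \<le> \<kappa>"
    using assms \<kappa> by (auto simp: c_def field_simps)
  have "\<exists>G. sinkless_digraph G \<and>
      1 * real n \<le> real (card (pverts G)) \<and> real (card (pverts G)) \<le> 9 * real n \<and>
      1 * real m \<le> real (card (parcs G)) \<and> real (card (parcs G)) \<le> 9 * real m \<and>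
      (\<forall>L A. adj_lists_of G L \<longrightarrow> solves_single_pair \<alpha> \<epsilon> p\<^sub>f A \<longrightarrow>
        (let d = real m / real n in
          ennreal (c * min (real m) (min ((d / \<delta>) powr (1 / 2)) ((1 / \<delta>) powr (2 / 3))))
            \<le> average_expected_time G L A \<delta>))"
    if n: "1 \<le> n" "n \<le> m" "m \<le> n ^ 2" and \<delta>: "0 < \<delta>" "\<delta> \<le> 1" for n m :: nat and \<delta> :: real
  proof -
    define \<mu> where "\<mu> = min (real m) (min ((real m / real n / \<delta>) powr (1 / 2)) ((1 / \<delta>) powr (2 / 3)))"
    have \<mu>_nonneg: "0 \<le> \<mu>" by (simp add: \<mu>_def)
    have "\<exists>G. sinkless_digraph G \<and> n \<le> card (pverts G) \<and> card (pverts G) \<le> 9 * n \<and>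
      m \<le> card (parcs G) \<and> card (parcs G) \<le> 9 * m \<and>
      (\<forall>L A. adj_lists_of G L \<longrightarrow> solves_single_pair \<alpha> \<epsilon> p\<^sub>f A \<longrightarrow>
        ennreal (c * \<mu>) \<le> average_expected_time G L A \<delta>)"
    proof (cases "1 \<le> \<kappa> / \<delta>")
      case True
      from exists_group_sizes[OF n True] obtain g h where gh: "1 \<le> g" "g \<le> h" "h \<le> n" "g * n \<le> m"
        "real g * real h ^ 2 \<le> \<kappa> / \<delta>"
        "min (real m) (min (sqrt (real m / real n * (\<kappa> / \<delta>))) ((\<kappa> / \<delta>) powr (2 / 3))) \<le> 4 * real (g * h)"
        by blast
      obtain P where "hard_graph n m g h P"
        using exists_hard_graph gh n by blast
      then interpret hard_graph n m g h P .
      \<comment> \<open>As \<open>\<kappa> \<le> 1\<close>, it is at most its own power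
        \<open>\<kappa> powr r\<close>, and can be moved inside.\<close>
      have le_powr: "\<kappa> * x powr r \<le> (\<kappa> * x) powr r" if "r \<le> 1" "0 \<le> x" for x r
        using powr_mono'[of r 1 \<kappa>] \<kappa> that by (auto simp: powr_mult intro!: mult_right_mono)
      have "\<kappa> * \<mu> = min (\<kappa> * real m) (min (\<kappa> * (real m / real n / \<delta>) powr (1 / 2)) (\<kappa> * (1 / \<delta>) powr (2 / 3)))"
        using \<kappa> by (simp add: \<mu>_def min_mult_distrib_left)
      also have "\<dots> \<le> min (real m) (min ((\<kappa> * (real m / real n / \<delta>)) powr (1 / 2)) ((\<kappa> * (1 / \<delta>)) powr (2 / 3)))"
        using \<kappa> \<delta> by (intro min.mono le_powr) (auto simp: mult_left_le_one_le)
      also have "\<dots> = min (real m) (min (sqrt (real m / real n * (\<kappa> / \<delta>))) ((\<kappa> / \<delta>) powr (2 / 3)))"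
        using \<kappa> \<delta> by (simp add: powr_half_sqrt mult_ac)
      also have "\<dots> \<le> 4 * real (g * h)" by (rule gh(6))
      finally have "(1 - 2 * p\<^sub>f) / 2592 * (\<kappa> * \<mu>) \<le> (1 - 2 * p\<^sub>f) / 2592 * (4 * real (g * h))"
        using assms by (intro mult_left_mono) auto
      moreover have "c * \<mu> = (1 - 2 * p\<^sub>f) / 2592 * (\<kappa> * \<mu>)"
        by (simp add: c_def)
      ultimately have le: "c * \<mu> \<le> (1 - 2 * p\<^sub>f) / 648 * real (g * h)"
        by linarith
      have "ennreal (c * \<mu>) \<le> average_expected_time G L A \<delta>"
        if L: "adj_lists_of G L" and A: "solves_single_pair \<alpha> \<epsilon> p\<^sub>f A" for L A
      proof (rule order_trans[OF ennreal_leI[OF le]])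
        show "ennreal ((1 - 2 * p\<^sub>f) / 648 * real (g * h)) \<le> average_expected_time G L A \<delta>"
          by (rule average_expected_time_ge_groups[OF assms(1-4) less_imp_le[OF assms(5)]
            less_imp_le[OF assms(6)] \<delta> gh(5)[unfolded \<kappa>_def] A L])
      qed
      then show ?thesis
        using sinkless card_pverts_ge card_pverts_le card_parcs_ge card_parcs_le by blast
    next
      \<comment> \<open>Now \<open>\<kappa> < \<delta>\<close>, so the claimed bound is at most 1
        and holds because every run takes at least one step; \<open>g = h = 1\<close> is merely an
        admissible choice.\<close>
      case False
      obtain P where "hard_graph n m 1 1 P"
        using exists_hard_graph[of 1 1 n m] n by auto
      then interpret hard_graph n m 1 1 P .
      have "\<mu> \<le> (1 / \<delta>) powr (2 / 3)" by (simp add: \<mu>_def)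
      also have "\<dots> \<le> (1 / \<delta>) powr 1" using \<delta> by (intro powr_mono) auto
      finally have "\<kappa> * \<mu> \<le> \<kappa> / \<delta>" using \<kappa> \<delta> by (simp add: field_simps)
      moreover have "c * \<mu> \<le> \<kappa> * \<mu>" using c \<mu>_nonneg by (intro mult_right_mono)
      ultimately have c1: "c * \<mu> \<le> 1" using False by linarith
      have "ennreal (c * \<mu>) \<le> average_expected_time G L A \<delta>" for L A
      proof -
        have fin: "finite (pverts G)" using sinkless by (simp add: sinkless_digraph_iff)
        have "ennreal (real (card (pverts G)) * real (card (pverts G)) * 1 / real (card (pverts G)) ^ 2)
            \<le> average_expected_time G L A \<delta>"
          using fin card_pverts_ge n_pos one_le_expected_time
          by (intro average_expected_time_ge) auto
        then have "1 \<le> average_expected_time G L A \<delta>"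
          using card_pverts_ge n_pos by (simp add: power2_eq_square)
        then show ?thesis using order_trans[OF ennreal_leI[OF c1]] by simp
      qed
      then show ?thesis
        using sinkless card_pverts_ge card_pverts_le card_parcs_ge card_parcs_le by blast
    qed
    then obtain G where G: "sinkless_digraph G" "n \<le> card (pverts G)" "card (pverts G) \<le> 9 * n"
        "m \<le> card (parcs G)" "card (parcs G) \<le> 9 * m"
      and time: "\<forall>L A. adj_lists_of G L \<longrightarrow> solves_single_pair \<alpha> \<epsilon> p\<^sub>f A \<longrightarrow>
        ennreal (c * \<mu>) \<le> average_expected_time G L A \<delta>"
      by blast
    have "real (card (pverts G)) \<le> 9 * real n" "real (card (parcs G)) \<le> 9 * real m"
      using G(3,5) by linarith+
    then show ?thesis
      using G time unfolding \<mu>_def Let_def by (intro exI[of _ G]) simp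
  qed
  note main = this
  show ?thesis
    by (rule exI[of _ 1], rule exI[of _ 9], rule exI[of _ 1], rule exI[of _ 9], rule exI[of _ c],
        intro conjI allI impI)
      (simp, simp, simp, simp, rule c(1), rule main)
qed

end
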